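(* Let $n\in\mathbb{N}$. The class of essentially smooth functions in $\mathcal{A}(\mathbb{R}^n)$ is cyclically involutive.
   Context: $\mathcal{A}(\mathcal{H})$ denotes the set of proper, lower-semicontinuous, convex functions $\mathcal{H}\to\mathbb{R}\cup\{+\infty\}$ on a real Hilbert space $\mathcal{H}$ (here $\mathcal{H}=\mathbb{R}^n$ with the dot product). A function $f\in\mathcal{A}(\mathbb{R}^n)$ is essentially smooth if, with $C=\operatorname{int}(\operatorname{dom} f)$, $\operatorname{dom} f=\{x: f(x)\in\mathbb{R}\}$: (a) $C\neq\emptyset$; (b) $f$ is differentiable throughout $C$; (c) $\lim_{i\to\infty}|\nabla f(x_i)|=+\infty$ whenever $x_1,x_2,\dots$ is a sequence in $C$ converging to a boundary point of $C$. For $N\ge 2$, $c(x_1,\dots,x_N)=\sum_{1\le i<j\le N}\langle x_i,x_j\rangle$ on $\mathcal{H}^N$. For proper functions $f_1,\dots,f_N$ on $\mathcal{H}$ and $1\le i\le N$, $$\Big(\bigoplus_{j\ne i}f_j\Big)^c(x_i):=\sup_{x_j\in\mathcal{H},\ j\ne i}\Big(c(x_1,\dots,x_N)-\sum_{j\ne i}f_j(x_j)\Big).$$ A subset $\Omega\subseteq\mathcal{A}(\mathcal{H})$ is $N$-cyclically involutive if for any $f_1,\dots,f_N\in\Omega$ satisfying $f_i(x_i)=\big(\bigoplus_{j\ne i}f_j\big)^c(x_i)$ for all $x_i\in\mathcal{H}$ and every $i=2,\dots,N$, one also has $f_1(x_1)=\big(\bigoplus_{j\ne 1}f_j\big)^c(x_1)$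 for all $x_1\in\mathcal{H}$. $\Omega$ is cyclically involutive if it is $N$-cyclically involutive for every $N\ge 2$. *)

theory Defs
  imports "HOL-Analysis.Analysis"
begin

text \<open>Functions with values in the extended half-line are rendered as functions into
  \<^typ>\<open>ereal\<close>; properness excludes the value minus infinity.\<close>

definition proper_fun :: "('a \<Rightarrow> ereal) \<Rightarrow> bool" where
  "proper_fun f \<longleftrightarrow> (\<forall>x. f x \<noteq> -\<infinity>) \<and> (\<exists>x. f x \<noteq> \<infinity>)"

definition eff_domain :: "('a \<Rightarrow> ereal) \<Rightarrow> 'a set" where
  "eff_domain f = {x. \<bar>f x\<bar> \<noteq> \<infinity>}"

definition lower_semicontinuous :: "('a::topological_space \<Rightarrow> ereal) \<Rightarrow> bool" where
  "lower_semicontinuous f \<longleftrightarrow> (\<forall>x. f x \<le> Liminf (at x) f)"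

text \<open>The library's \<^term>\<open>convex_on\<close> is restricted to real-valued functions.  The weights below
  are strictly positive, so no product of zero and infinity occurs.\<close>

definition convex_fun :: "('a::real_vector \<Rightarrow> ereal) \<Rightarrow> bool" where
  "convex_fun f \<longleftrightarrow> (\<forall>x y t. 0 < t \<longrightarrow> t < 1 \<longrightarrow>
     f ((1 - t) *\<^sub>R x + t *\<^sub>R y) \<le> ereal (1 - t) * f x + ereal t * f y)"

definition proper_lsc_convex :: "('a::{real_inner,complete_space} \<Rightarrow> ereal) set" where
  "proper_lsc_convex = {f. proper_fun f \<and> lower_semicontinuous f \<and> convex_fun f}"

definition gradient :: "('a::real_inner \<Rightarrow> real) \<Rightarrow> 'a \<Rightarrow> 'a" where
  "gradient g x = (THE D. GDERIV g x :> D)"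

text \<open>On the open set \<open>C\<close> the function \<open>f\<close> is finite, so differentiability of
  \<open>f\<close> at points of \<open>C\<close> is that of \<^term>\<open>real_of_ereal \<circ> f\<close>, whose values outside
  \<open>C\<close> are irrelevant.\<close>

definition essentially_smooth :: "(real ^ 'n \<Rightarrow> ereal) \<Rightarrow> bool" where
  "essentially_smooth f \<longleftrightarrow>
     (let C = interior (eff_domain f); g = real_of_ereal \<circ> f in
        C \<noteq> {} \<and>
        (\<forall>x\<in>C. g differentiable (at x)) \<and>
        (\<forall>X b. (\<forall>i. X i \<in> C) \<longrightarrow> b \<in> frontier C \<longrightarrow> X \<longlonglongrightarrow> b \<longrightarrow>
           filterlim (\<lambda>i. norm (gradient g (X i))) at_top sequentially))"

text \<open>An \<open>N\<close>-tuple is a function on \<^typ>\<open>nat\<close> of which only the values on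
  \<open>{1..N}\<close> are used.\<close>

definition inner_cost :: "nat \<Rightarrow> (nat \<Rightarrow> 'a::real_inner) \<Rightarrow> real" where
  "inner_cost N x = (\<Sum>(i, j) \<in> {(i, j). 1 \<le> i \<and> i < j \<and> j \<le> N}. x i \<bullet> x j)"

definition multi_conjugate ::
    "nat \<Rightarrow> (nat \<Rightarrow> 'a::real_inner \<Rightarrow> ereal) \<Rightarrow> nat \<Rightarrow> 'a \<Rightarrow> ereal" where
  "multi_conjugate N f i z =
     (SUP x\<in>{x. x i = z}. ereal (inner_cost N x) - (\<Sum>j\<in>{1..N} - {i}. f j (x j)))"

definition N_cyclically_involutive ::
    "nat \<Rightarrow> ('a::{real_inner,complete_space} \<Rightarrow> ereal) set \<Rightarrow> bool" where
  "N_cyclically_involutive N \<Omega> \<longleftrightarrow> \<Omega> \<subseteq> proper_lsc_convex \<and>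
     (\<forall>f. (\<forall>i\<in>{1..N}. f i \<in> \<Omega>) \<longrightarrow>
          (\<forall>i\<in>{2..N}. \<forall>z. f i z = multi_conjugate N f i z) \<longrightarrow>
          (\<forall>z. f 1 z = multi_conjugate N f 1 z))"

definition cyclically_involutive :: "('a::{real_inner,complete_space} \<Rightarrow> ereal) set \<Rightarrow> bool" where
  "cyclically_involutive \<Omega> \<longleftrightarrow> (\<forall>N\<ge>2. N_cyclically_involutive N \<Omega>)"

end

theory Submission
  imports Defs
begin

text \<open>Write \<open>q = |\<cdot>|\<^sup>2/2\<close>.  The cost is \<open>q (\<Sum>\<^sub>j x\<^sub>j) - \<Sum>\<^sub>j q (x\<^sub>j)\<close>, so everything can be expressed through
  the conjugates \<open>u\<^sub>j\<close> of the strongly convex functions \<open>f\<^sub>j + q\<close>, which are finite, convex and hence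
  continuous; the supremum defining \<open>u\<^sub>j p\<close> is attained at the proximal point of \<open>p\<close>.  The inequality
  \<open>c \<le> \<Sum>\<^sub>j f\<^sub>j\<close> amounts to \<open>\<Sum>\<^sub>j u\<^sub>j \<le> q\<close>, and the point is that a single conjugacy equation, at some index
  \<open>i\<close>, already forces equality \<open>\<Sum>\<^sub>j u\<^sub>j = q\<close> (\<open>sum_reg_conjugate_eq\<close>).  This condition is symmetric in
  the indices, so it yields the conjugacy equation at every other index.

  To get equality at \<open>p\<close>, let \<open>z\<close> be the proximal point of \<open>p\<close> for \<open>f\<^sub>i\<close>, and take tuples that approach
  the supremum representing \<open>f\<^sub>i z\<close>.  Their sums \<open>y\<close> satisfy \<open>\<Sum>\<^sub>j u\<^sub>j y \<approx> q y\<close>, and \<open>u\<^sub>i\<close> at \<open>y\<close> is close to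
  its tangent at \<open>p\<close>, whose slope is \<open>z\<close>.  Essential smoothness of \<open>f\<^sub>i\<close> makes \<open>u\<^sub>i\<close> strictly convex: two
  points at which \<open>u\<^sub>i\<close> touches this tangent would give two subgradients of \<open>f\<^sub>i\<close> at \<open>z\<close>, but subgradients
  of \<open>f\<^sub>i\<close> exist only in the interior of the domain (\<open>essentially_smooth_subgradient_in_interior\<close>),
  where they equal the gradient.  Hence the sums tend to \<open>p\<close>
  (\<open>reg_conjugate_gap_tendsto\<close>) and equality passes to the limit.

  Conversely, equality of \<open>\<Sum>\<^sub>j u\<^sub>j\<close> and \<open>q\<close> shows that the multi-conjugate at \<open>x\<close> dominates \<open>f\<^sub>1\<close> at the
  minimisers of \<open>f\<^sub>1 + k/2 |\<cdot> - x|\<^sup>2\<close> for \<open>k \<ge> 1\<close> (\<open>multi_conjugate_ge_at_prox\<close>).  When the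
  multi-conjugate at \<open>x\<close> is finite, these converge to \<open>x\<close> as \<open>k\<close> grows, and lower semicontinuity of \<open>f\<^sub>1\<close> concludes.\<close>

section \<open>Lower semicontinuity\<close>

lemma lower_semicontinuous_eventually:
  assumes "lower_semicontinuous f" "a < f z"
  shows "eventually (\<lambda>y. a < f y) (nhds z)"
proof -
  have "a < Liminf (at z) f"
    using assms unfolding lower_semicontinuous_def by (meson less_le_trans)
  then have "eventually (\<lambda>y. a < f y) (at z)"
    by (rule less_LiminfD)
  then show ?thesis
    using assms(2) by (auto simp: eventually_at_filter elim: eventually_mono)
qed

lemma lower_semicontinuous_add_continuous:
  fixes f :: "'a::t2_space \<Rightarrow> ereal"
  assumes lsc: "lower_semicontinuous f" and cont: "\<And>z. isCont c z"
  shows "lower_semicontinuous (\<lambda>y. f y + ereal (c y))"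
  unfolding lower_semicontinuous_def le_Liminf_iff
proof (intro allI impI)
  fix z a assume a: "a < f z + ereal (c z)"
  then have "a - ereal (c z) < f z"
    by (cases a; cases "f z") auto
  then obtain b where b: "a - ereal (c z) < ereal b" "ereal b < f z"
    using ereal_dense2 by blast
  show "\<forall>\<^sub>F y in at z. a < f y + ereal (c y)"
  proof (cases a)
    case (real r)
    then have "r - b < c z"
      using b by auto
    then have "\<forall>\<^sub>F y in at z. r - b < c y"
      using cont[of z] unfolding isCont_def by (rule order_tendstoD(1)[rotated])
    moreover have "\<forall>\<^sub>F y in at z. ereal b < f y"
      using lower_semicontinuous_eventually[OF lsc b(2)]
      by (auto simp: eventually_at_filter elim: eventually_mono)
    ultimately show ?thesis
    proof eventually_elim
      case (elim y)
      then show ?case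
        using real by (cases "f y") auto
    qed
  next
    case PInf
    then show ?thesis using a by simp
  next
    case MInf
    have "\<forall>\<^sub>F y in at z. ereal b < f y"
      using lower_semicontinuous_eventually[OF lsc b(2)]
      by (auto simp: eventually_at_filter elim: eventually_mono)
    then show ?thesis
    proof eventually_elim
      case (elim y)
      then show ?case
        using MInf by (cases "f y") auto
    qed
  qed
qed

lemma lower_semicontinuous_attains_min:
  fixes f :: "'a::topological_space \<Rightarrow> ereal"
  assumes lsc: "lower_semicontinuous f" and K: "compact K" "K \<noteq> {}"
  shows "\<exists>z\<in>K. \<forall>y\<in>K. f z \<le> f y"
proof (rule ccontr)
  assume "\<not> ?thesis"
  then have ex: "\<forall>z\<in>K. \<exists>y\<in>K. f y < f z"
    by (metis not_le)
  \<comment> \<open>The sets of points at which \<open>f\<close> exceeds one of its values on \<open>K\<close> would be an open cover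
    of \<open>K\<close>; a finite subcover misses the point of smallest value among its indices.\<close>
  have op: "open {z. f y < f z}" for y
  proof (subst open_subopen, safe)
    fix z assume "f y < f z"
    from lower_semicontinuous_eventually[OF lsc this]
    show "\<exists>T. open T \<and> z \<in> T \<and> T \<subseteq> {z. f y < f z}"
      unfolding eventually_nhds by blast
  qed
  have "K \<subseteq> (\<Union>y\<in>K. {z. f y < f z})"
    using ex by blast
  then obtain T where T: "T \<subseteq> K" "finite T" "K \<subseteq> (\<Union>y\<in>T. {z. f y < f z})"
    using compactE_image[OF K(1), of K "\<lambda>y. {z. f y < f z}"] op by blast
  have "T \<noteq> {}"
    using T K by auto
  then have "Min (f ` T) \<in> f ` T"
    using T by (intro Min_in) auto
  then obtain m where m: "m \<in> T" "f m = Min (f ` T)"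
    by (metis imageE)
  then obtain y where "y \<in> T" "f y < f m"
    using T by blast
  then show False
    using m T by (metis Min_le finite_imageI image_eqI not_le)
qed

section \<open>Subgradients\<close>

text \<open>The vector \<open>v\<close> is a subgradient of \<open>f\<close> at \<open>z\<close>: the affine function with slope \<open>v\<close> that agrees
  with \<open>f\<close> at \<open>z\<close> is a minorant of \<open>f\<close>.  The value \<open>f z\<close> is required to be finite.\<close>

definition subgradient :: "('a::real_inner \<Rightarrow> ereal) \<Rightarrow> 'a \<Rightarrow> 'a \<Rightarrow> bool" where
  "subgradient f z v \<longleftrightarrow> z \<in> eff_domain f \<and>
     (\<forall>y. ereal (real_of_ereal (f z) + v \<bullet> (y - z)) \<le> f y)"

lemma eff_domain_eq: "z \<in> eff_domain f \<Longrightarrow> f z = ereal (real_of_ereal (f z))"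
  by (auto simp: eff_domain_def ereal_real)

lemma convex_fun_segment:
  assumes "convex_fun f" "proper_fun f" "x \<in> eff_domain f" "y \<in> eff_domain f" "0 < t" "t < 1"
  shows "(1 - t) *\<^sub>R x + t *\<^sub>R y \<in> eff_domain f"
    and "real_of_ereal (f ((1 - t) *\<^sub>R x + t *\<^sub>R y))
      \<le> (1 - t) * real_of_ereal (f x) + t * real_of_ereal (f y)"
proof -
  let ?w = "(1 - t) *\<^sub>R x + t *\<^sub>R y"
  have "f ?w \<le> ereal (1 - t) * f x + ereal t * f y"
    using assms unfolding convex_fun_def by blast
  also have "\<dots> = ereal ((1 - t) * real_of_ereal (f x) + t * real_of_ereal (f y))"
    using eff_domain_eq[OF assms(3)] eff_domain_eq[OF assms(4)]
    by (metis plus_ereal.simps(1) times_ereal.simps(1))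
  finally have le: "f ?w \<le> ereal ((1 - t) * real_of_ereal (f x) + t * real_of_ereal (f y))" .
  moreover have "f ?w \<noteq> -\<infinity>"
    using assms(2) unfolding proper_fun_def by blast
  ultimately show "?w \<in> eff_domain f"
    by (auto simp: eff_domain_def)
  from eff_domain_eq[OF this] le
  show "real_of_ereal (f ?w) \<le> (1 - t) * real_of_ereal (f x) + t * real_of_ereal (f y)"
    by (metis ereal_less_eq(3))
qed

lemma convex_eff_domain:
  assumes "convex_fun f" "proper_fun f"
  shows "convex (eff_domain f)"
  unfolding convex_alt
proof (intro ballI allI impI)
  fix x y and t :: real
  assume "x \<in> eff_domain f" "y \<in> eff_domain f" "0 \<le> t \<and> t \<le> 1"
  then show "(1 - t) *\<^sub>R x + t *\<^sub>R y \<in> eff_domain f"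
    using convex_fun_segment(1)[OF assms, of x y t] by (cases "t = 0"; cases "t = 1") auto
qed

lemma has_gradient:
  fixes g :: "'a::euclidean_space \<Rightarrow> real"
  assumes "g differentiable (at x)"
  shows "GDERIV g x :> gradient g x"
proof -
  obtain L where L: "(g has_derivative L) (at x)"
    using assms unfolding differentiable_def by blast
  have "L h = h \<bullet> adjoint L 1" for h
    using adjoint_works[OF has_derivative_linear[OF L], of h 1] by simp
  then have "L = (\<lambda>h. h \<bullet> adjoint L 1)"
    by (rule ext)
  with L have "GDERIV g x :> adjoint L 1"
    unfolding gderiv_def by argo
  moreover have "D = E" if "GDERIV g x :> D" "GDERIV g x :> E" for D E
  proof -
    have "(\<lambda>h. h \<bullet> D) = (\<lambda>h. h \<bullet> E)"
      using that unfolding gderiv_def by (rule has_derivative_unique)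
    then show "D = E"
      by (metis vector_eq_ldot)
  qed
  ultimately show ?thesis
    unfolding gradient_def by (metis theI)
qed

lemma directional_derivative:
  assumes "GDERIV g x :> D"
  shows "((\<lambda>t. (g (x + t *\<^sub>R h) - g x) / t) \<longlongrightarrow> h \<bullet> D) (at 0)"
proof -
  have "((\<lambda>t. x + t *\<^sub>R h) has_derivative (\<lambda>t. t *\<^sub>R h)) (at 0)"
    by (auto intro!: derivative_eq_intros)
  moreover have "(g has_derivative (\<lambda>h. h \<bullet> D)) (at (x + 0 *\<^sub>R h))"
    using assms by (simp add: gderiv_def)
  ultimately have "((\<lambda>t. g (x + t *\<^sub>R h)) has_derivative (\<lambda>t. (t *\<^sub>R h) \<bullet> D)) (at 0)"
    by (rule has_derivative_compose)
  then have "((\<lambda>t. g (x + t *\<^sub>R h)) has_field_derivative (h \<bullet> D)) (at 0)"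
    by (rule has_derivative_imp_has_field_derivative) simp
  then show ?thesis
    by (simp add: has_field_derivative_iff)
qed

lemma gradient_is_subgradient:
  fixes f :: "'a::euclidean_space \<Rightarrow> ereal"
  assumes "convex_fun f" "proper_fun f" "x \<in> eff_domain f"
    and "(real_of_ereal \<circ> f) differentiable (at x)"
  shows "subgradient f x (gradient (real_of_ereal \<circ> f) x)"
  unfolding subgradient_def
proof (intro conjI allI)
  let ?g = "real_of_ereal \<circ> f"
  let ?D = "gradient ?g x"
  fix y
  show "ereal (real_of_ereal (f x) + ?D \<bullet> (y - x)) \<le> f y"
  proof (cases "y \<in> eff_domain f")
    case True
    have "((\<lambda>t. (?g (x + t *\<^sub>R (y - x)) - ?g x) / t) \<longlongrightarrow> (y - x) \<bullet> ?D) (at_right 0)"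
      using directional_derivative[OF has_gradient[OF assms(4)]] filterlim_at_split by blast
    moreover have "\<forall>\<^sub>F t in at_right 0. (?g (x + t *\<^sub>R (y - x)) - ?g x) / t \<le> ?g y - ?g x"
      unfolding eventually_at_right_field
    proof (intro exI[of _ 1] conjI allI impI)
      fix t :: real assume t: "0 < t" "t < 1"
      have "x + t *\<^sub>R (y - x) = (1 - t) *\<^sub>R x + t *\<^sub>R y"
        by (simp add: algebra_simps)
      then have "?g (x + t *\<^sub>R (y - x)) - ?g x \<le> (?g y - ?g x) * t"
        using convex_fun_segment(2)[OF assms(1-3) True t] by (simp add: algebra_simps)
      then show "(?g (x + t *\<^sub>R (y - x)) - ?g x) / t \<le> ?g y - ?g x"
        using t by (simp add: divide_le_eq)
    qed simp
    ultimately have "(y - x) \<bullet> ?D \<le> ?g y - ?g x"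
      by (rule tendsto_upperbound) simp
    then have "real_of_ereal (f x) + ?D \<bullet> (y - x) \<le> real_of_ereal (f y)"
      by (simp add: inner_commute)
    then show ?thesis
      by (subst eff_domain_eq[OF True]) simp
  next
    case False
    then have "f y = \<infinity>"
      using assms(2) by (auto simp: eff_domain_def proper_fun_def)
    then show ?thesis by simp
  qed
qed (fact assms(3))

lemma subgradient_eq_gradient:
  fixes f :: "'a::euclidean_space \<Rightarrow> ereal"
  assumes v: "subgradient f x v" and int: "x \<in> interior (eff_domain f)"
    and diff: "(real_of_ereal \<circ> f) differentiable (at x)"
  shows "v = gradient (real_of_ereal \<circ> f) x"
proof -
  let ?g = "real_of_ereal \<circ> f"
  let ?D = "gradient ?g x"
  let ?h = "\<lambda>y. ?g y - v \<bullet> y"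
  obtain L where L: "L = (\<lambda>h. h \<bullet> (?D - v))" "(?h has_derivative L) (at x)"
  proof
    have "(?g has_derivative (\<lambda>h. h \<bullet> ?D)) (at x)"
      using has_gradient[OF diff] by (simp add: gderiv_def)
    then show "(?h has_derivative (\<lambda>h. h \<bullet> (?D - v))) (at x)"
      by (intro derivative_eq_intros | assumption)+ (auto simp: inner_diff_right inner_commute)
  qed simp
  obtain e where e: "0 < e" "ball x e \<subseteq> eff_domain f"
    using int by (meson mem_interior)
  have "?h x \<le> ?h y" if "y \<in> ball x e" for y
  proof -
    have "ereal (real_of_ereal (f x) + v \<bullet> (y - x)) \<le> ereal (real_of_ereal (f y))"
      using v that e eff_domain_eq unfolding subgradient_def by (metis subsetD)
    then show ?thesis
      by (simp add: inner_diff_right)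
  qed
  then have "L = (\<lambda>h. 0)"
    using L(2) e(1) by (intro has_derivative_local_min[where f = ?h and x = x])
      (auto simp: eventually_at dist_commute intro!: exI[of _ e])
  then have "(?D - v) \<bullet> (?D - v) = 0"
    using L(1) by metis
  then show ?thesis by simp
qed

text \<open>Attainment of the proximal minimisation problem
  \<open>f y + k/2 |y - a|\<^sup>2\<close>, stated through its optimality condition.  The hypothesis that \<open>f\<close> has some
  subgradient supplies an affine minorant, hence coercivity.\<close>

lemma proximal_point_exists:
  fixes f :: "'a::euclidean_space \<Rightarrow> ereal"
  assumes conv: "convex_fun f" and proper: "proper_fun f" and lsc: "lower_semicontinuous f"
    and sub: "subgradient f c b" and k: "k > 0"
  shows "\<exists>z. subgradient f z (k *\<^sub>R (a - z))"
proof -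
  define F where "F = (\<lambda>y. real_of_ereal (f y))"
  define G where "G = (\<lambda>y. f y + ereal (k / 2 * (norm (y - a))\<^sup>2))"
  define v where "v = F c + k / 2 * (norm (c - a))\<^sup>2"
  define \<alpha> where "\<alpha> = F c + b \<bullet> (a - c)"
  \<comment> \<open>Beyond this radius the quadratic term dominates the affine minorant, so \<open>G \<ge> G c\<close>.\<close>
  define R where "R = Max {2 * (norm b + 1) / k, v - \<alpha>, norm (c - a)}"
  have R: "2 * (norm b + 1) / k \<le> R" "v - \<alpha> \<le> R" "norm (c - a) \<le> R"
    unfolding R_def by auto
  have c: "c \<in> eff_domain f" and minor: "ereal (F c + b \<bullet> (y - c)) \<le> f y" for y
    using sub unfolding subgradient_def F_def by auto
  have Gc: "G c = ereal v"
    unfolding G_def v_def F_def by (subst eff_domain_eq[OF c]) simp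
  have far: "ereal v \<le> G y" if "R < norm (y - a)" for y
  proof -
    let ?d = "norm (y - a)"
    have "0 \<le> ?d" by simp
    have "2 * (norm b + 1) / k \<le> ?d"
      using R that by linarith
    then have "2 * (norm b + 1) \<le> ?d * k"
      using k by (simp add: pos_divide_le_eq)
    then have "(norm b + 1) * ?d \<le> (?d * k / 2) * ?d"
      by (intro mult_right_mono) auto
    then have "norm b * ?d + ?d \<le> k / 2 * ?d\<^sup>2"
      by (simp add: algebra_simps power2_eq_square)
    moreover have "- (b \<bullet> (y - a)) \<le> norm b * ?d"
      using Cauchy_Schwarz_ineq2[of b "y - a"] by linarith
    moreover have "F c + b \<bullet> (y - c) = \<alpha> + b \<bullet> (y - a)"
      unfolding \<alpha>_def by (simp add: inner_diff_right)
    ultimately have "v \<le> F c + b \<bullet> (y - c) + k / 2 * ?d\<^sup>2"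
      using R that by linarith
    then have "ereal v \<le> ereal (F c + b \<bullet> (y - c)) + ereal (k / 2 * ?d\<^sup>2)"
      by simp
    also have "\<dots> \<le> G y"
      unfolding G_def using minor by (intro add_right_mono)
    finally show ?thesis .
  qed
  have "c \<in> cball a R"
    using R by (simp add: dist_norm norm_minus_commute)
  moreover have "lower_semicontinuous G"
    unfolding G_def using lsc by (rule lower_semicontinuous_add_continuous) simp
  moreover have "compact (cball a R)"
    by simp
  ultimately obtain z where z: "z \<in> cball a R" "\<forall>y\<in>cball a R. G z \<le> G y"
    using lower_semicontinuous_attains_min[of G "cball a R"] by blast
  have min: "G z \<le> G y" for y
  proof (cases "y \<in> cball a R")
    case False
    then have "R < norm (y - a)"
      by (simp add: dist_norm norm_minus_commute)
    moreover have "G z \<le> ereal v"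
      using z(2) \<open>c \<in> cball a R\<close> Gc by metis
    ultimately show ?thesis
      using far order_trans by blast
  qed (use z in blast)
  have zdom: "z \<in> eff_domain f"
  proof -
    have "f z \<noteq> \<infinity>"
      using min[of c, unfolded Gc] unfolding G_def by auto
    then show ?thesis
      using proper by (auto simp: proper_fun_def eff_domain_def)
  qed
  have minF: "F z + k / 2 * (norm (z - a))\<^sup>2 \<le> F y + k / 2 * (norm (y - a))\<^sup>2"
    if "y \<in> eff_domain f" for y
    using min[of y] unfolding G_def F_def
    by (subst (asm) eff_domain_eq[OF zdom], subst (asm) eff_domain_eq[OF that]) simp
  have "ereal (F z + (k *\<^sub>R (a - z)) \<bullet> (y - z)) \<le> f y" for y
  proof (cases "y \<in> eff_domain f")
    case True
    let ?A = "F z - F y + (k *\<^sub>R (a - z)) \<bullet> (y - z)"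
    \<comment> \<open>Comparing \<open>z\<close> with the points of the segment towards \<open>y\<close> gives the inequality up to a term
      of second order.\<close>
    have "?A \<le> t * (k / 2 * (norm (y - z))\<^sup>2)" if t: "0 < t" "t < 1" for t
    proof -
      let ?w = "(1 - t) *\<^sub>R z + t *\<^sub>R y"
      have w: "?w \<in> eff_domain f" "F ?w \<le> (1 - t) * F z + t * F y"
        using convex_fun_segment[OF conv proper zdom True t] unfolding F_def by auto
      have "?w - a = (z - a) + t *\<^sub>R (y - z)"
        by (simp add: algebra_simps)
      then have "(norm (?w - a))\<^sup>2 = (norm (z - a))\<^sup>2 + 2 * t * ((z - a) \<bullet> (y - z))
          + t * t * (norm (y - z))\<^sup>2"
        by (simp only: power2_norm_eq_inner)
          (simp add: inner_add_left inner_add_right inner_commute)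
      then have "k / 2 * (norm (?w - a))\<^sup>2 = k / 2 * (norm (z - a))\<^sup>2
          + k * (t * ((z - a) \<bullet> (y - z))) + t * (t * (k / 2 * (norm (y - z))\<^sup>2))"
        by (simp add: field_simps)
      then have "F z \<le> (1 - t) * F z + t * F y + k * (t * ((z - a) \<bullet> (y - z)))
          + t * (t * (k / 2 * (norm (y - z))\<^sup>2))"
        using minF[OF w(1)] w(2) by linarith
      moreover have "(k *\<^sub>R (a - z)) \<bullet> (y - z) = - (k * ((z - a) \<bullet> (y - z)))"
        by (simp add: inner_diff_left right_diff_distrib)
      ultimately have "t * ?A \<le> t * (t * (k / 2 * (norm (y - z))\<^sup>2))"
        by (simp only: ring_distribs left_diff_distrib right_diff_distrib) (simp add: mult.left_commute)
      then show ?thesis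
        using t by simp
    qed
    then have "\<forall>\<^sub>F t in at_right 0. ?A \<le> t * (k / 2 * (norm (y - z))\<^sup>2)"
      unfolding eventually_at_right_field by (intro exI[of _ 1]) simp
    moreover have "((\<lambda>t. t * (k / 2 * (norm (y - z))\<^sup>2)) \<longlongrightarrow> 0 * (k / 2 * (norm (y - z))\<^sup>2))
        (at_right 0)"
      by (intro tendsto_intros)
    ultimately have "?A \<le> 0"
      by (metis mult_zero_left tendsto_lowerbound trivial_limit_at_right_real)
    then show ?thesis
      by (subst eff_domain_eq[OF True]) (simp add: F_def)
  next
    case False
    then have "f y = \<infinity>"
      using proper by (auto simp: eff_domain_def proper_fun_def)
    then show ?thesis by simp
  qed
  then show ?thesis
    using zdom unfolding subgradient_def F_def by blast
qed

section \<open>Subgradients of essentially smooth functions\<close>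

lemma essentially_smooth_interior_subgradient:
  fixes f :: "real ^ 'n \<Rightarrow> ereal"
  assumes "convex_fun f" "proper_fun f" "essentially_smooth f" "x \<in> interior (eff_domain f)"
  shows "subgradient f x (gradient (real_of_ereal \<circ> f) x)"
  using assms interior_subset
  by (intro gradient_is_subgradient) (auto simp: essentially_smooth_def Let_def)

text \<open>Along the segment from an interior point \<open>c\<close> to a boundary
  point \<open>z\<close> carrying a subgradient, the gradients stay bounded: their components along
  \<open>c - z\<close> are bounded below because of the subgradient at \<open>z\<close>, and the values of \<open>f\<close> near \<open>c\<close> then
  control their norms.  This contradicts their blow-up at the boundary.\<close>

lemma essentially_smooth_subgradient_in_interior:
  fixes f :: "real ^ 'n \<Rightarrow> ereal"
  assumes conv: "convex_fun f" and proper: "proper_fun f" and es: "essentially_smooth f"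
    and sub: "subgradient f z v"
  shows "z \<in> interior (eff_domain f)"
proof (rule ccontr)
  assume nz: "z \<notin> interior (eff_domain f)"
  define C where "C = interior (eff_domain f)"
  define F where "F = real_of_ereal \<circ> f"
  define D where "D = gradient F"
  have es': "C \<noteq> {}" "\<And>x. x \<in> C \<Longrightarrow> F differentiable (at x)"
    "\<And>X b. (\<forall>i. X i \<in> C) \<Longrightarrow> b \<in> frontier C \<Longrightarrow> X \<longlonglongrightarrow> b
      \<Longrightarrow> filterlim (\<lambda>i. norm (D (X i))) at_top sequentially"
    using es unfolding essentially_smooth_def Let_def C_def F_def D_def by blast+
  have Cdom: "C \<subseteq> eff_domain f"
    unfolding C_def by (rule interior_subset)
  have zdom: "z \<in> eff_domain f"
    using sub unfolding subgradient_def by blast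
  have subz: "F z + v \<bullet> (y - z) \<le> F y" if "y \<in> eff_domain f" for y
    using sub eff_domain_eq[OF that] unfolding subgradient_def F_def
    by (metis comp_apply ereal_less_eq(3))
  have subC: "F x + D x \<bullet> (y - x) \<le> F y" if "x \<in> C" "y \<in> eff_domain f" for x y
    using essentially_smooth_interior_subgradient[OF conv proper es, of x] that
      eff_domain_eq[OF that(2)] unfolding subgradient_def F_def D_def C_def
    by (metis comp_apply ereal_less_eq(3))
  obtain c where c: "c \<in> C"
    using es'(1) by blast
  define t where "t = (\<lambda>i. 1 / real (i + 2))"
  define X where "X = (\<lambda>i. z + t i *\<^sub>R (c - z))"
  have t: "0 < t i" "t i < 1" for i
    unfolding t_def by auto
  have "X i \<in> C" for i
  proof -
    have "z - t i *\<^sub>R (z - c) \<in> interior (eff_domain f)"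
      using t[of i] c zdom convex_eff_domain[OF conv proper] unfolding C_def
      by (intro mem_interior_convex_shrink) auto
    then show ?thesis
      unfolding X_def C_def by (simp add: algebra_simps)
  qed
  note XC = this
  have lim: "X \<longlonglongrightarrow> z"
  proof -
    have "t \<longlonglongrightarrow> 0"
      using LIMSEQ_ignore_initial_segment[OF lim_1_over_n, of 2] unfolding t_def by simp
    then have "X \<longlonglongrightarrow> z + 0 *\<^sub>R (c - z)"
      unfolding X_def by (intro tendsto_intros)
    then show ?thesis by simp
  qed
  have "z \<in> frontier C"
    using nz XC lim unfolding frontier_def C_def
    by (auto simp: closure_sequential intro!: exI[of _ X])
  then have top: "filterlim (\<lambda>i. norm (D (X i))) at_top sequentially"
    using es'(3) XC lim by blast
  have "isCont F c"
    using es'(2)[OF c] by (rule differentiable_imp_continuous_within)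
  then have "\<forall>\<^sub>F y in at c. F y < F c + 1"
    unfolding isCont_def by (rule order_tendstoD) simp
  then obtain e where e: "e > 0" "\<And>y. y \<noteq> c \<Longrightarrow> dist y c < e \<Longrightarrow> F y < F c + 1"
    unfolding eventually_at by auto
  obtain e' where e': "e' > 0" "ball c e' \<subseteq> eff_domain f"
    using c unfolding C_def mem_interior by blast
  define r where "r = min e e' / 2"
  have r: "0 < r" "r < e" "r < e'"
    unfolding r_def using e e' by auto
  define K where "K = \<bar>v \<bullet> (c - z)\<bar>"
  have bound: "norm (D (X i)) \<le> (F c + 1 - F z + 2 * K) / r" for i
  proof (cases "D (X i) = 0")
    case True
    have "F z + v \<bullet> (c - z) \<le> F c"
      using subz c Cdom by blast
    then have "0 \<le> F c + 1 - F z + 2 * K"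
      unfolding K_def by linarith
    then show ?thesis
      using True r by simp
  next
    case False
    let ?D = "D (X i)"
    let ?y = "c + (r / norm ?D) *\<^sub>R ?D"
    have XzK: "F z - t i * K \<le> F (X i)"
    proof -
      have "F z + t i * (v \<bullet> (c - z)) \<le> F (X i)"
        using subz[of "X i"] XC[of i] Cdom unfolding X_def by auto
      moreover have "- (t i * K) \<le> t i * (v \<bullet> (c - z))"
        using t[of i] unfolding K_def by (metis abs_ge_minus_self abs_minus_cancel
            minus_le_iff mult_left_mono mult_minus_right order_less_imp_le)
      ultimately show ?thesis by linarith
    qed
    have "F (X i) + ?D \<bullet> (z - X i) \<le> F z"
      using subC XC zdom by blast
    then have "F (X i) - t i * (?D \<bullet> (c - z)) \<le> F z"
      unfolding X_def by simp
    then have "t i * (- K) \<le> t i * (?D \<bullet> (c - z))"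
      using XzK by simp
    then have DK: "- K \<le> ?D \<bullet> (c - z)"
      using t[of i] by (meson mult_le_cancel_left_pos)
    have dist: "dist ?y c = r"
      using False r by (simp add: dist_norm)
    moreover have "?y \<noteq> c"
      using False r by simp
    ultimately have Fy: "F ?y < F c + 1" and ydom: "?y \<in> eff_domain f"
      using e e' r by (auto simp: dist_commute subset_iff)
    have "F (X i) + ?D \<bullet> (?y - X i) \<le> F ?y"
      using subC XC ydom by blast
    moreover have "?y - X i = (1 - t i) *\<^sub>R (c - z) + (r / norm ?D) *\<^sub>R ?D"
      unfolding X_def by (simp add: algebra_simps)
    moreover have "?D \<bullet> ((r / norm ?D) *\<^sub>R ?D) = r * norm ?D"
      using False by (simp add: dot_square_norm power2_eq_square)
    ultimately have "F (X i) + (1 - t i) * (?D \<bullet> (c - z)) + r * norm ?D < F c + 1"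
      using Fy by (simp add: inner_add_right)
    moreover have "(1 - t i) * (- K) \<le> (1 - t i) * (?D \<bullet> (c - z))"
      using t[of i] DK by (intro mult_left_mono) auto
    ultimately have "F z - K + r * norm ?D < F c + 1"
      using XzK by (simp add: algebra_simps)
    moreover have "0 \<le> K"
      unfolding K_def by simp
    ultimately have "r * norm ?D \<le> F c + 1 - F z + 2 * K"
      by linarith
    then show ?thesis
      using r by (simp add: pos_le_divide_eq mult.commute)
  qed
  have "\<forall>\<^sub>F i in sequentially. (F c + 1 - F z + 2 * K) / r < norm (D (X i))"
    using top unfolding filterlim_at_top_dense by blast
  then show False
    using bound by (auto simp: eventually_sequentially not_less[symmetric])
qed

lemma essentially_smooth_subgradient_unique:
  fixes f :: "real ^ 'n \<Rightarrow> ereal"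
  assumes "convex_fun f" "proper_fun f" "essentially_smooth f"
    and "subgradient f z v" "subgradient f z w"
  shows "v = w"
proof -
  have z: "z \<in> interior (eff_domain f)"
    using essentially_smooth_subgradient_in_interior assms by blast
  then have "(real_of_ereal \<circ> f) differentiable (at z)"
    using assms(3) by (auto simp: essentially_smooth_def Let_def)
  then show ?thesis
    using subgradient_eq_gradient[OF _ z] assms by metis
qed

section \<open>The regularized conjugate\<close>

text \<open>The proximal point of \<open>p\<close>, that is the minimiser of \<open>f y + |y - p|\<^sup>2/2\<close>, described by its
  optimality condition.  It exists and is unique for proper, lower semicontinuous, convex functions
  having a subgradient, by \<open>proximal_point_exists\<close> and \<open>subgradient_imp_prox_eq\<close>.\<close>

definition prox :: "('a::real_inner \<Rightarrow> ereal) \<Rightarrow> 'a \<Rightarrow> 'a" where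
  "prox f p = (SOME z. subgradient f z (p - z))"

text \<open>The convex conjugate of \<open>f + |\<cdot>|\<^sup>2/2\<close>, as a real-valued function: the supremum
  of \<open>p \<bullet> y - |y|\<^sup>2/2 - f y\<close> over \<open>y\<close> is attained at the proximal point of \<open>p\<close>.\<close>

definition reg_conjugate :: "('a::real_inner \<Rightarrow> ereal) \<Rightarrow> 'a \<Rightarrow> real" where
  "reg_conjugate f p =
     p \<bullet> prox f p - (prox f p \<bullet> prox f p) / 2 - real_of_ereal (f (prox f p))"

lemma subgradient_ineq:
  assumes "subgradient f z v" "y \<in> eff_domain f"
  shows "real_of_ereal (f z) + v \<bullet> (y - z) \<le> real_of_ereal (f y)"
  using assms eff_domain_eq[OF assms(2)] unfolding subgradient_def
  by (metis ereal_less_eq(3))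

lemma subgradient_prox:
  assumes "\<exists>z. subgradient f z (p - z)"
  shows "subgradient f (prox f p) (p - prox f p)"
  unfolding prox_def using assms by (rule someI_ex)

lemma subgradient_imp_prox_eq:
  assumes "subgradient f z (p - z)"
  shows "prox f p = z"
proof -
  let ?w = "prox f p"
  have w: "subgradient f ?w (p - ?w)"
    using assms by (intro subgradient_prox) blast
  have "(p - z) \<bullet> (?w - z) + (p - ?w) \<bullet> (z - ?w) \<le> 0"
    using subgradient_ineq[OF assms, of ?w] subgradient_ineq[OF w, of z] assms w
    unfolding subgradient_def by linarith
  then have "(?w - z) \<bullet> (?w - z) \<le> 0"
    by (simp add: inner_diff_left inner_diff_right inner_commute)
  then show ?thesis
    using inner_ge_zero[of "?w - z"] by simp
qed

lemma reg_conjugate_ge: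
  assumes "\<exists>z. subgradient f z (p - z)" "y \<in> eff_domain f"
  shows "p \<bullet> y - (y \<bullet> y) / 2 - real_of_ereal (f y) + (y - prox f p) \<bullet> (y - prox f p) / 2
    \<le> reg_conjugate f p"
  using subgradient_ineq[OF subgradient_prox[OF assms(1)] assms(2)]
  unfolding reg_conjugate_def
  by (simp add: inner_diff_left inner_diff_right inner_commute algebra_simps)
    (simp add: field_simps)

lemma reg_conjugate_ge':
  assumes "\<exists>z. subgradient f z (p - z)" "y \<in> eff_domain f"
  shows "p \<bullet> y - (y \<bullet> y) / 2 - real_of_ereal (f y) \<le> reg_conjugate f p"
  using reg_conjugate_ge[OF assms] inner_ge_zero[of "y - prox f p"] by linarith

lemma convex_on_reg_conjugate:
  assumes ex: "\<And>p. \<exists>z. subgradient f z (p - z)"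
  shows "convex_on UNIV (reg_conjugate f)"
proof (rule convex_onI)
  fix t :: real and p q :: 'a
  assume t: "0 < t" "t < 1"
  let ?w = "(1 - t) *\<^sub>R p + t *\<^sub>R q"
  let ?z = "prox f ?w"
  have z: "?z \<in> eff_domain f"
    using subgradient_prox[OF ex] unfolding subgradient_def by blast
  have "reg_conjugate f ?w
      = (1 - t) * (p \<bullet> ?z - (?z \<bullet> ?z) / 2 - real_of_ereal (f ?z))
        + t * (q \<bullet> ?z - (?z \<bullet> ?z) / 2 - real_of_ereal (f ?z))"
    unfolding reg_conjugate_def[of f ?w] inner_add_left inner_scaleR_left
    by (simp add: field_simps)
  also have "\<dots> \<le> (1 - t) * reg_conjugate f p + t * reg_conjugate f q"
    using t reg_conjugate_ge'[OF ex z] by (intro add_mono mult_left_mono) auto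
  finally show "reg_conjugate f ?w \<le> (1 - t) * reg_conjugate f p + t * reg_conjugate f q" .
qed simp

lemma continuous_reg_conjugate:
  fixes f :: "'a::euclidean_space \<Rightarrow> ereal"
  assumes "\<And>p. \<exists>z. subgradient f z (p - z)"
  shows "isCont (reg_conjugate f) p"
  using convex_on_continuous[OF open_UNIV convex_on_reg_conjugate[OF assms]]
  by (simp add: continuous_on_eq_continuous_at)

lemma essentially_smooth_scaled_prox_exists:
  fixes f :: "real ^ 'n \<Rightarrow> ereal"
  assumes "f \<in> proper_lsc_convex" "essentially_smooth f" "k > 0"
  shows "\<exists>z. subgradient f z (k *\<^sub>R (a - z))"
proof -
  have f: "convex_fun f" "proper_fun f" "lower_semicontinuous f"
    using assms(1) unfolding proper_lsc_convex_def by auto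
  obtain c where "c \<in> interior (eff_domain f)"
    using assms(2) unfolding essentially_smooth_def Let_def by blast
  from proximal_point_exists[OF f essentially_smooth_interior_subgradient[OF f(1,2) assms(2) this]
      assms(3)]
  show ?thesis .
qed

lemma essentially_smooth_prox_exists:
  fixes f :: "real ^ 'n \<Rightarrow> ereal"
  assumes "f \<in> proper_lsc_convex" "essentially_smooth f"
  shows "\<exists>z. subgradient f z (p - z)"
  using essentially_smooth_scaled_prox_exists[OF assms, of 1 p] by simp

lemma convex_strict_min_tendsto:
  fixes U :: "'a::euclidean_space \<Rightarrow> real"
  assumes conv: "convex_on UNIV U" and zero: "U p = 0" and pos: "\<And>y. y \<noteq> p \<Longrightarrow> 0 < U y"
    and lim: "(\<lambda>n. U (Y n)) \<longlonglongrightarrow> 0"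
  shows "Y \<longlonglongrightarrow> p"
proof (rule metric_LIMSEQ_I)
  fix e :: real assume e: "0 < e"
  have "continuous_on (sphere p e) U"
    using convex_on_continuous[OF open_UNIV conv] by (rule continuous_on_subset) simp
  moreover have "sphere p e \<noteq> {}"
    using e by simp
  ultimately obtain m where m: "m \<in> sphere p e" "\<forall>y\<in>sphere p e. U m \<le> U y"
    using continuous_attains_inf[OF compact_sphere] by blast
  have Um: "0 < U m"
    using m(1) e pos[of m] by auto
  have far: "U m \<le> U y" if "e \<le> dist y p" for y
  proof -
    define t where "t = e / dist y p"
    have "0 < dist y p"
      using e that by linarith
    then have t: "0 < t" "t \<le> 1"
      using e that unfolding t_def by simp_all
    let ?w = "(1 - t) *\<^sub>R p + t *\<^sub>R y"
    have "?w - p = t *\<^sub>R (y - p)"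
      by (simp add: algebra_simps)
    then have "dist ?w p = t * dist y p"
      using t by (simp add: dist_norm)
    also have "\<dots> = e"
      using e that unfolding t_def by auto
    finally have "U m \<le> U ?w"
      using m by (simp add: dist_commute)
    also have "\<dots> \<le> (1 - t) * U p + t * U y"
      using t conv by (intro convex_onD) auto
    also have "\<dots> \<le> U y"
      using t zero mult_right_mono[of t 1 "U y"] pos[of y] \<open>0 < dist y p\<close> by auto
    finally show ?thesis .
  qed
  have "\<forall>\<^sub>F n in sequentially. U (Y n) < U m"
    using lim Um by (rule order_tendstoD)
  then have "\<forall>\<^sub>F n in sequentially. dist (Y n) p < e"
    by eventually_elim (use far in \<open>force simp: not_less[symmetric]\<close>)
  then show "\<exists>N. \<forall>n\<ge>N. dist (Y n) p < e"
    by (simp add: eventually_sequentially)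
qed

text \<open>Essential smoothness of \<open>f\<close> makes the regularized conjugate strictly convex.  The form used
  is that the gap between the regularized conjugate and its tangent at \<open>p\<close>, whose slope is
  the proximal point of \<open>p\<close>, can only vanish in the limit along sequences tending to \<open>p\<close>.\<close>

lemma reg_conjugate_gap_tendsto:
  fixes f :: "real ^ 'n \<Rightarrow> ereal"
  assumes f: "f \<in> proper_lsc_convex" "essentially_smooth f" and z: "z = prox f p"
    and lim: "(\<lambda>n. reg_conjugate f (Y n) - (Y n \<bullet> z - (z \<bullet> z) / 2 - real_of_ereal (f z))) \<longlonglongrightarrow> 0"
  shows "Y \<longlonglongrightarrow> p"
proof -
  note ex = essentially_smooth_prox_exists[OF f]
  define c where "c = (z \<bullet> z) / 2 + real_of_ereal (f z)"
  define U where "U = (\<lambda>y. reg_conjugate f y + (c - y \<bullet> z))"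
  have sub: "subgradient f z (p - z)"
    unfolding z using ex by (rule subgradient_prox)
  then have zdom: "z \<in> eff_domain f"
    unfolding subgradient_def by blast
  have "convex_on UNIV (\<lambda>y. c - y \<bullet> z)"
    by (rule convex_onI) (auto simp: algebra_simps inner_add_left)
  then have "convex_on UNIV U"
    unfolding U_def by (intro convex_on_add convex_on_reg_conjugate ex)
  moreover have "U p = 0"
    unfolding U_def c_def reg_conjugate_def z by simp
  moreover have "0 < U y" if "y \<noteq> p" for y
  proof (rule ccontr)
    assume "\<not> 0 < U y"
    moreover have "(z - prox f y) \<bullet> (z - prox f y) / 2 \<le> U y"
      using reg_conjugate_ge[OF ex zdom, of y] unfolding U_def c_def by linarith
    ultimately have "(z - prox f y) \<bullet> (z - prox f y) \<le> 0"
      by linarith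
    then have "z = prox f y"
      using inner_ge_zero[of "z - prox f y"] by simp
    then have "subgradient f z (y - z)"
      using subgradient_prox[OF ex] by metis
    then have "y - z = p - z"
      using essentially_smooth_subgradient_unique sub f unfolding proper_lsc_convex_def by blast
    then show False
      using that by simp
  qed
  moreover have "(\<lambda>n. U (Y n)) \<longlonglongrightarrow> 0"
    using lim unfolding U_def c_def by (simp add: algebra_simps)
  ultimately show ?thesis
    by (rule convex_strict_min_tendsto)
qed

section \<open>The multi-marginal cost\<close>

lemma inner_cost_eq:
  "inner_cost N x = ((\<Sum>i\<in>{1..N}. x i) \<bullet> (\<Sum>i\<in>{1..N}. x i) - (\<Sum>i\<in>{1..N}. x i \<bullet> x i)) / 2"
proof (induction N)
  case 0
  have empty: "{(i, j). 1 \<le> i \<and> i < j \<and> j \<le> (0::nat)} = {}"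
    by auto
  show ?case
    unfolding inner_cost_def empty by simp
next
  case (Suc N)
  let ?A = "{(i, j). 1 \<le> i \<and> i < j \<and> j \<le> N}"
  let ?B = "(\<lambda>i. (i, Suc N)) ` {1..N}"
  have "{(i, j). 1 \<le> i \<and> i < j \<and> j \<le> Suc N} = ?A \<union> ?B"
    by (auto simp: le_Suc_eq)
  moreover have "finite ?A"
    by (rule finite_subset[of _ "{1..N} \<times> {1..N}"]) auto
  moreover have "?A \<inter> ?B = {}"
    by auto
  ultimately have "inner_cost (Suc N) x
      = inner_cost N x + (\<Sum>(i, j)\<in>?B. x i \<bullet> x j)"
    unfolding inner_cost_def by (simp add: sum.union_disjoint)
  also have "(\<Sum>(i, j)\<in>?B. x i \<bullet> x j) = (\<Sum>i\<in>{1..N}. x i) \<bullet> x (Suc N)"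
    by (subst sum.reindex) (auto simp: inj_on_def inner_sum_left)
  finally show ?case
    using Suc.IH
    by (simp add: inner_add_left inner_add_right inner_commute field_simps)
qed

lemma multi_conjugate_ge:
  assumes "\<And>j. j \<in> {1..N} - {i} \<Longrightarrow> x j \<in> eff_domain (f j)"
  shows "ereal (inner_cost N x - (\<Sum>j\<in>{1..N} - {i}. real_of_ereal (f j (x j))))
    \<le> multi_conjugate N f i (x i)"
proof -
  have "(\<Sum>j\<in>{1..N} - {i}. f j (x j))
      = (\<Sum>j\<in>{1..N} - {i}. ereal (real_of_ereal (f j (x j))))"
    using assms by (intro sum.cong eff_domain_eq) auto
  then have "ereal (inner_cost N x - (\<Sum>j\<in>{1..N} - {i}. real_of_ereal (f j (x j))))
      = ereal (inner_cost N x) - (\<Sum>j\<in>{1..N} - {i}. f j (x j))"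
    by (simp add: sum_ereal)
  also have "\<dots> \<le> multi_conjugate N f i (x i)"
    unfolding multi_conjugate_def by (rule SUP_upper) simp
  finally show ?thesis .
qed

lemma multi_conjugate_approx:
  assumes proper: "\<And>j. j \<in> {1..N} \<Longrightarrow> proper_fun (f j)"
    and less: "ereal a < multi_conjugate N f i z"
  shows "\<exists>x. x i = z \<and> (\<forall>j\<in>{1..N} - {i}. x j \<in> eff_domain (f j)) \<and>
    a < inner_cost N x - (\<Sum>j\<in>{1..N} - {i}. real_of_ereal (f j (x j)))"
proof -
  let ?J = "{1..N} - {i}"
  obtain x where x: "x i = z" "ereal a < ereal (inner_cost N x) - (\<Sum>j\<in>?J. f j (x j))"
    using less unfolding multi_conjugate_def less_SUP_iff by blast
  have "(\<Sum>j\<in>?J. f j (x j)) \<noteq> \<infinity>"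
    using x(2) by auto
  then have "\<forall>j\<in>?J. f j (x j) \<noteq> \<infinity>"
    by (simp add: sum_Pinfty)
  moreover have "\<forall>j\<in>?J. f j (x j) \<noteq> -\<infinity>"
    using proper unfolding proper_fun_def by simp
  ultimately have dom: "\<forall>j\<in>?J. x j \<in> eff_domain (f j)"
    unfolding eff_domain_def by force
  then have "(\<Sum>j\<in>?J. f j (x j)) = (\<Sum>j\<in>?J. ereal (real_of_ereal (f j (x j))))"
    by (intro sum.cong eff_domain_eq) auto
  then have "a < inner_cost N x - (\<Sum>j\<in>?J. real_of_ereal (f j (x j)))"
    using x(2) by (simp add: sum_ereal)
  then show ?thesis
    using x(1) dom by blast
qed

section \<open>Cyclic involutivity\<close>

text \<open>If the tuple satisfies the conjugacy equation at one index \<open>i\<close> then the regularized conjugates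
  add up to \<open>|\<cdot>|\<^sup>2/2\<close>.  Write \<open>s = \<Sum>\<^sub>j x\<^sub>j\<close> and \<open>q = |\<cdot>|\<^sup>2/2\<close>; since the cost is
  \<open>q s - \<Sum>\<^sub>j q (x\<^sub>j)\<close>, the inequality \<open>\<le>\<close> is Young's inequality.  For equality at \<open>p\<close>, a tuple that
  nearly attains the supremum at the proximal point of \<open>p\<close> has its sum \<open>s\<close> near \<open>p\<close>, by strict
  convexity of the \<open>i\<close>-th regularized conjugate, and equality nearly holds at \<open>s\<close>.\<close>

lemma sum_reg_conjugate_eq:
  fixes f :: "nat \<Rightarrow> real ^ 'n \<Rightarrow> ereal"
  assumes f: "\<And>j. j \<in> {1..N} \<Longrightarrow> f j \<in> proper_lsc_convex \<and> essentially_smooth (f j)"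
    and i: "i \<in> {1..N}" and conj: "\<And>z. f i z = multi_conjugate N f i z"
  shows "(\<Sum>j\<in>{1..N}. reg_conjugate (f j) p) = (p \<bullet> p) / 2"
proof (rule antisym)
  let ?F = "\<lambda>j y. real_of_ereal (f j y)"
  let ?S = "\<lambda>y. \<Sum>j\<in>{1..N}. reg_conjugate (f j) y"
  have ex: "\<exists>z. subgradient (f j) z (p - z)" if "j \<in> {1..N}" for j p
    using essentially_smooth_prox_exists f[OF that] by blast
  have dom: "prox (f j) p \<in> eff_domain (f j)" if "j \<in> {1..N}" for j p
    using subgradient_prox[OF ex[OF that]] unfolding subgradient_def by blast
  have proper: "proper_fun (f j)" if "j \<in> {1..N}" for j
    using f[OF that] unfolding proper_lsc_convex_def by blast
  have split: "(\<Sum>j\<in>{1..N}. g j) = g i + (\<Sum>j\<in>{1..N} - {i}. g j)" for g :: "nat \<Rightarrow> real"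
    using i by (simp add: sum.remove)
  have upper: "?S p \<le> (p \<bullet> p) / 2" for p
  proof -
    let ?x = "\<lambda>j. prox (f j) p"
    let ?s = "\<Sum>j\<in>{1..N}. ?x j"
    have "ereal (inner_cost N ?x - (\<Sum>j\<in>{1..N} - {i}. ?F j (?x j))) \<le> f i (?x i)"
      unfolding conj[of "?x i"] using dom by (intro multi_conjugate_ge) auto
    then have "inner_cost N ?x - (\<Sum>j\<in>{1..N} - {i}. ?F j (?x j)) \<le> ?F i (?x i)"
      using eff_domain_eq[OF dom[OF i]] by (metis ereal_less_eq(3))
    then have *: "inner_cost N ?x \<le> (\<Sum>j\<in>{1..N}. ?F j (?x j))"
      unfolding split[of "\<lambda>j. ?F j (?x j)"] by linarith
    have "?S p = p \<bullet> ?s - (\<Sum>j\<in>{1..N}. ?x j \<bullet> ?x j) / 2 - (\<Sum>j\<in>{1..N}. ?F j (?x j))"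
      unfolding reg_conjugate_def by (simp add: sum_subtractf inner_sum_right sum_divide_distrib)
    also have "\<dots> \<le> p \<bullet> ?s - (?s \<bullet> ?s) / 2"
      using * unfolding inner_cost_eq by (simp add: field_simps)
    also have "\<dots> \<le> (p \<bullet> p) / 2"
      using inner_ge_zero[of "p - ?s"]
      by (simp add: inner_diff_left inner_diff_right inner_commute)
    finally show ?thesis .
  qed
  show "?S p \<le> (p \<bullet> p) / 2"
    by (rule upper)
  define z where "z = prox (f i) p"
  \<comment> \<open>The tangent at \<open>p\<close> of the \<open>i\<close>-th regularized conjugate.\<close>
  define T where "T = (\<lambda>y. y \<bullet> z - (z \<bullet> z) / 2 - ?F i z)"
  have zdom: "z \<in> eff_domain (f i)"
    unfolding z_def by (rule dom[OF i])
  have gap: "0 \<le> reg_conjugate (f i) y - T y" for y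
    using reg_conjugate_ge'[OF ex[OF i] zdom, of y] unfolding T_def by simp
  \<comment> \<open>The witness is the sum of a tuple that attains the supremum for \<open>f i z\<close> up to \<open>e\<close>.\<close>
  have "\<exists>y. reg_conjugate (f i) y - T y < e \<and> (y \<bullet> y) / 2 - e < ?S y" if "0 < e" for e
  proof -
    have "ereal (?F i z - e) < multi_conjugate N f i z"
      unfolding conj[symmetric] using that by (subst (2) eff_domain_eq[OF zdom]) simp
    then obtain x where x: "x i = z" "\<forall>j\<in>{1..N} - {i}. x j \<in> eff_domain (f j)"
        "?F i z - e < inner_cost N x - (\<Sum>j\<in>{1..N} - {i}. ?F j (x j))"
      using multi_conjugate_approx[of N f "?F i z - e" i z] proper by blast
    define y where "y = (\<Sum>j\<in>{1..N}. x j)"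
    let ?t = "\<lambda>j. y \<bullet> x j - (x j \<bullet> x j) / 2 - ?F j (x j)"
    have "(\<Sum>j\<in>{1..N}. ?t j)
        = y \<bullet> y - (\<Sum>j\<in>{1..N}. x j \<bullet> x j) / 2 - (\<Sum>j\<in>{1..N}. ?F j (x j))"
      by (simp add: sum_subtractf y_def inner_sum_right sum_divide_distrib)
    also have "\<dots> = (y \<bullet> y) / 2 + inner_cost N x - (\<Sum>j\<in>{1..N}. ?F j (x j))"
      unfolding inner_cost_eq y_def[symmetric] by (simp add: field_simps)
    also have "\<dots> > (y \<bullet> y) / 2 - e"
      using x(3) unfolding split[of "\<lambda>j. ?F j (x j)"] x(1) by simp
    finally have "(y \<bullet> y) / 2 - e < T y + (\<Sum>j\<in>{1..N} - {i}. ?t j)"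
      unfolding split[of ?t] T_def x(1) by simp
    also have "(\<Sum>j\<in>{1..N} - {i}. ?t j) \<le> (\<Sum>j\<in>{1..N} - {i}. reg_conjugate (f j) y)"
      using x(2) ex by (intro sum_mono reg_conjugate_ge') auto
    finally have "(y \<bullet> y) / 2 - e < T y + (\<Sum>j\<in>{1..N} - {i}. reg_conjugate (f j) y)"
      by simp
    then have "(y \<bullet> y) / 2 - e < ?S y - (reg_conjugate (f i) y - T y)"
      unfolding split[of "\<lambda>j. reg_conjugate (f j) y"] by simp
    then show ?thesis
      using gap[of y] upper[of y] by (intro exI[of _ y]) linarith
  qed
  then have "\<exists>y. reg_conjugate (f i) y - T y < inverse (real (Suc n))
      \<and> (y \<bullet> y) / 2 - inverse (real (Suc n)) < ?S y" for n
    by simp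
  then obtain Y where Y: "\<And>n. reg_conjugate (f i) (Y n) - T (Y n) < inverse (real (Suc n))"
      "\<And>n. (Y n \<bullet> Y n) / 2 - inverse (real (Suc n)) < ?S (Y n)"
    by metis
  have inv: "(\<lambda>n. inverse (real (Suc n))) \<longlonglongrightarrow> 0"
    by (rule LIMSEQ_inverse_real_of_nat)
  have "(\<lambda>n. reg_conjugate (f i) (Y n) - T (Y n)) \<longlonglongrightarrow> 0"
    by (rule tendsto_sandwich[OF always_eventually[OF allI] always_eventually[OF allI]
          tendsto_const inv]) (rule gap, rule less_imp_le[OF Y(1)])
  then have lim: "Y \<longlonglongrightarrow> p"
    using f[OF i] unfolding T_def by (intro reg_conjugate_gap_tendsto[OF _ _ z_def]) auto
  have "(\<lambda>n. ?S (Y n)) \<longlonglongrightarrow> ?S p"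
    using ex lim by (intro tendsto_sum isCont_tendsto_compose[OF continuous_reg_conjugate]) auto
  moreover have "(\<lambda>n. (Y n \<bullet> Y n) / 2 - inverse (real (Suc n))) \<longlonglongrightarrow> (p \<bullet> p) / 2 - 0"
    by (intro tendsto_intros lim inv) simp
  ultimately have "(p \<bullet> p) / 2 - 0 \<le> ?S p"
    using less_imp_le[OF Y(2)] by (intro LIMSEQ_le) blast+
  then show "(p \<bullet> p) / 2 \<le> ?S p"
    by simp
qed

text \<open>The hypothesis on \<open>z\<close> says that it is the proximal point of \<open>x\<close> for the penalty
  \<open>k/2 |\<cdot> - x|\<^sup>2\<close> (when \<open>k > 0\<close>).  The supremum is tested with the tuple of proximal
  points of \<open>p = z + k (x - z)\<close>, which has \<open>z\<close> as its proximal point for \<open>f\<^sub>i\<close>.\<close>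

lemma multi_conjugate_ge_at_prox:
  fixes f :: "nat \<Rightarrow> 'a::real_inner \<Rightarrow> ereal"
  assumes ex: "\<And>j p. j \<in> {1..N} \<Longrightarrow> \<exists>z. subgradient (f j) z (p - z)"
    and i: "i \<in> {1..N}"
    and sum: "\<And>p. (\<Sum>j\<in>{1..N}. reg_conjugate (f j) p) = (p \<bullet> p) / 2"
    and z: "subgradient (f i) z (k *\<^sub>R (x - z))"
  shows "ereal (real_of_ereal (f i z) + (k - 1 / 2) * (norm (x - z))\<^sup>2) \<le> multi_conjugate N f i x"
proof -
  let ?F = "\<lambda>j y. real_of_ereal (f j y)"
  let ?J = "{1..N} - {i}"
  define p where "p = z + k *\<^sub>R (x - z)"
  define X where "X = (\<lambda>j. if j = i then x else prox (f j) p)"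
  define s where "s = (\<Sum>j\<in>{1..N}. X j)"
  have pz: "prox (f i) p = z"
    using z unfolding p_def by (intro subgradient_imp_prox_eq) simp
  have Xi: "X i = x"
    unfolding X_def by simp
  have "X j \<in> eff_domain (f j)" if "j \<in> ?J" for j
    using subgradient_prox[OF ex] that unfolding subgradient_def X_def by auto
  then have ge: "ereal (inner_cost N X - (\<Sum>j\<in>?J. ?F j (X j))) \<le> multi_conjugate N f i x"
    using multi_conjugate_ge[of N i X f] unfolding Xi by blast
  have split: "(\<Sum>j\<in>{1..N}. g j) = g i + (\<Sum>j\<in>?J. g j)" for g :: "nat \<Rightarrow> real"
    using i by (simp add: sum.remove)
  have "(\<Sum>j\<in>?J. reg_conjugate (f j) p)
      = (\<Sum>j\<in>?J. p \<bullet> X j - (X j \<bullet> X j) / 2 - ?F j (X j))"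
    unfolding reg_conjugate_def X_def by (intro sum.cong) auto
  also have "\<dots> = (\<Sum>j\<in>?J. p \<bullet> X j) - (\<Sum>j\<in>?J. X j \<bullet> X j) / 2 - (\<Sum>j\<in>?J. ?F j (X j))"
    by (simp add: sum_subtractf sum_divide_distrib)
  also have "(\<Sum>j\<in>?J. p \<bullet> X j) = p \<bullet> s - p \<bullet> x"
    using split[of "\<lambda>j. p \<bullet> X j"] unfolding s_def inner_sum_right Xi by simp
  also have "(\<Sum>j\<in>?J. X j \<bullet> X j) = (\<Sum>j\<in>{1..N}. X j \<bullet> X j) - x \<bullet> x"
    using split[of "\<lambda>j. X j \<bullet> X j"] unfolding Xi by simp
  finally have "(p \<bullet> p) / 2 - reg_conjugate (f i) p
      = p \<bullet> s - p \<bullet> x - ((\<Sum>j\<in>{1..N}. X j \<bullet> X j) - x \<bullet> x) / 2 - (\<Sum>j\<in>?J. ?F j (X j))"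
    using split[of "\<lambda>j. reg_conjugate (f j) p"] sum[of p] by linarith
  moreover have "p \<bullet> s \<le> (p \<bullet> p) / 2 + (s \<bullet> s) / 2"
    using inner_ge_zero[of "p - s"]
    by (simp add: inner_diff_left inner_diff_right inner_commute)
  moreover have "inner_cost N X = (s \<bullet> s) / 2 - (\<Sum>j\<in>{1..N}. X j \<bullet> X j) / 2"
    unfolding inner_cost_eq s_def by (simp add: diff_divide_distrib)
  ultimately have "p \<bullet> x - (x \<bullet> x) / 2 - reg_conjugate (f i) p
      \<le> inner_cost N X - (\<Sum>j\<in>?J. ?F j (X j))"
    by (simp add: field_simps)
  moreover have "reg_conjugate (f i) p = p \<bullet> z - (z \<bullet> z) / 2 - ?F i z"
    unfolding reg_conjugate_def pz by (rule refl)
  then have "p \<bullet> x - (x \<bullet> x) / 2 - reg_conjugate (f i) p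
      = ?F i z + (k - 1 / 2) * (norm (x - z))\<^sup>2"
    unfolding p_def power2_norm_eq_inner
    by (simp add: inner_diff_left inner_diff_right inner_add_left inner_add_right inner_commute
        field_simps)
  ultimately show ?thesis
    using ge by (metis ereal_less_eq(3) order_trans)
qed

theorem corollary1p8:
  shows "cyclically_involutive
    {f :: real ^ 'n \<Rightarrow> ereal. f \<in> proper_lsc_convex \<and> essentially_smooth f}"
  unfolding cyclically_involutive_def N_cyclically_involutive_def
proof (intro allI impI conjI)
  fix N :: nat and f :: "nat \<Rightarrow> real ^ 'n \<Rightarrow> ereal" and x
  assume N: "2 \<le> N"
    and fcl: "\<forall>i\<in>{1..N}. f i \<in> {f. f \<in> proper_lsc_convex \<and> essentially_smooth f}"
    and conj: "\<forall>i\<in>{2..N}. \<forall>z. f i z = multi_conjugate N f i z"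
  let ?F = "\<lambda>j y. real_of_ereal (f j y)"
  have f: "f j \<in> proper_lsc_convex" "essentially_smooth (f j)" if "j \<in> {1..N}" for j
    using fcl that by auto
  have proper: "proper_fun (f j)" if "j \<in> {1..N}" for j
    using f[OF that] unfolding proper_lsc_convex_def by blast
  have N1: "1 \<in> {1..N}" and N2: "2 \<in> {1..N}"
    using N by auto
  have conj2: "f 2 z = multi_conjugate N f 2 z" for z
    using conj N by auto
  have sum: "(\<Sum>j\<in>{1..N}. reg_conjugate (f j) p) = (p \<bullet> p) / 2" for p
    using sum_reg_conjugate_eq[of N f 2 p] f N2 conj2 by blast
  have split: "(\<Sum>j\<in>{1..N}. g j) = g i + (\<Sum>j\<in>{1..N} - {i}. g j)"
    if "i \<in> {1..N}" for i and g :: "nat \<Rightarrow> real"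
    using that by (simp add: sum.remove)
  show "f 1 x = multi_conjugate N f 1 x"
  proof (rule antisym)
    show "multi_conjugate N f 1 x \<le> f 1 x"
    proof (rule ccontr)
      assume "\<not> ?thesis"
      then have "f 1 x < multi_conjugate N f 1 x"
        by simp
      then obtain a where a: "f 1 x < ereal a" "ereal a < multi_conjugate N f 1 x"
        using ereal_dense2 by blast
      then obtain X where X: "X 1 = x" "\<forall>j\<in>{1..N} - {1}. X j \<in> eff_domain (f j)"
          "a < inner_cost N X - (\<Sum>j\<in>{1..N} - {1}. ?F j (X j))"
        using multi_conjugate_approx[of N f a 1 x] proper by blast
      have "x \<in> eff_domain (f 1)"
        using a(1) proper[OF N1] by (auto simp: eff_domain_def proper_fun_def)
      then have Xdom: "X j \<in> eff_domain (f j)" if "j \<in> {1..N}" for j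
        using X that by (cases "j = 1") auto
      have "ereal (inner_cost N X - (\<Sum>j\<in>{1..N} - {2}. ?F j (X j))) \<le> f 2 (X 2)"
        unfolding conj2[of "X 2"] using Xdom by (intro multi_conjugate_ge) auto
      then have "inner_cost N X - (\<Sum>j\<in>{1..N} - {2}. ?F j (X j)) \<le> ?F 2 (X 2)"
        using eff_domain_eq[OF Xdom[OF N2]] by (metis ereal_less_eq(3))
      then have "a < ?F 1 x"
        using X(1,3) split[OF N1, of "\<lambda>j. ?F j (X j)"] split[OF N2, of "\<lambda>j. ?F j (X j)"]
        by simp
      then show False
        using a(1) eff_domain_eq[OF \<open>x \<in> eff_domain (f 1)\<close>] by (metis ereal_less(1)
            less_ereal.simps(1) not_less_iff_gr_or_eq)
    qed
  next
    show "f 1 x \<le> multi_conjugate N f 1 x"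
    proof (rule ccontr)
      assume "\<not> ?thesis"
      then have "multi_conjugate N f 1 x < f 1 x"
        by simp
      then obtain H where H: "multi_conjugate N f 1 x < ereal H" "ereal H < f 1 x"
        using ereal_dense2 by blast
      \<comment> \<open>The proximal points of \<open>x\<close> for the penalties \<open>(n + 1)/2 |\<cdot> - x|\<^sup>2\<close>: the values of
        \<open>f 1\<close> there stay below \<open>H\<close>, and the quadratic margin in this bound makes them converge
        to \<open>x\<close>.\<close>
      have "\<exists>z. subgradient (f 1) z (real (Suc n) *\<^sub>R (x - z))" for n
        using essentially_smooth_scaled_prox_exists[OF f[OF N1]] by simp
      then obtain Z where Z: "\<And>n. subgradient (f 1) (Z n) (real (Suc n) *\<^sub>R (x - Z n))"
        by metis
      have Zdom: "Z n \<in> eff_domain (f 1)" for n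
        using Z unfolding subgradient_def by blast
      have bound: "?F 1 (Z n) + (real (Suc n) - 1 / 2) * (norm (x - Z n))\<^sup>2 < H" for n
      proof -
        have "ereal (?F 1 (Z n) + (real (Suc n) - 1 / 2) * (norm (x - Z n))\<^sup>2)
            \<le> multi_conjugate N f 1 x"
          using essentially_smooth_prox_exists[OF f] N1 sum Z
          by (intro multi_conjugate_ge_at_prox) auto
        then show ?thesis
          using H(1) by (metis le_less_trans less_ereal.simps(1))
      qed
      \<comment> \<open>The slope of the affine minorant of \<open>f 1\<close> at \<open>Z 0\<close>, which bounds the values of \<open>f 1\<close>
        from below.\<close>
      define b where "b = x - Z 0"
      define M where "M = H - ?F 1 (Z 0) - b \<bullet> b + (b \<bullet> b) / 2"
      have small: "(norm (Z n - x))\<^sup>2 \<le> M / real n" if "n > 0" for n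
      proof -
        have "?F 1 (Z 0) + b \<bullet> (Z n - Z 0) \<le> ?F 1 (Z n)"
          using subgradient_ineq[OF Z[of 0] Zdom[of n]] unfolding b_def by simp
        moreover have "Z n - Z 0 = (Z n - x) + b"
          unfolding b_def by simp
        ultimately have "?F 1 (Z 0) + b \<bullet> (Z n - x) + b \<bullet> b \<le> ?F 1 (Z n)"
          by (simp add: inner_add_right)
        moreover have "- (b \<bullet> b) / 2 - (norm (Z n - x))\<^sup>2 / 2 \<le> b \<bullet> (Z n - x)"
          using inner_ge_zero[of "b + (Z n - x)"] unfolding power2_norm_eq_inner
          by (simp only: inner_add_left inner_add_right) (simp add: inner_commute)
        moreover have "?F 1 (Z n) + real n * (norm (Z n - x))\<^sup>2 + (norm (Z n - x))\<^sup>2 / 2 < H"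
          using bound[of n] by (simp add: norm_minus_commute algebra_simps)
        ultimately have "real n * (norm (Z n - x))\<^sup>2 \<le> M"
          unfolding M_def by linarith
        then show ?thesis
          using that by (simp add: pos_le_divide_eq mult.commute)
      qed
      have "(\<lambda>n. (norm (Z n - x))\<^sup>2) \<longlonglongrightarrow> 0"
        using small
        by (intro tendsto_sandwich[OF _ _ tendsto_const lim_const_over_n[of M]])
          (auto simp: eventually_sequentially intro!: exI[of _ 1])
      then have "(\<lambda>n. sqrt ((norm (Z n - x))\<^sup>2)) \<longlonglongrightarrow> sqrt 0"
        by (rule tendsto_real_sqrt)
      then have "(\<lambda>n. norm (Z n - x)) \<longlonglongrightarrow> 0"
        by simp
      then have "Z \<longlonglongrightarrow> x"
        by (simp add: LIM_zero_iff tendsto_norm_zero_iff)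
      moreover have "lower_semicontinuous (f 1)"
        using f[OF N1] unfolding proper_lsc_convex_def by blast
      then have "\<forall>\<^sub>F y in nhds x. ereal H < f 1 y"
        using H(2) by (rule lower_semicontinuous_eventually)
      ultimately have "\<forall>\<^sub>F n in sequentially. ereal H < f 1 (Z n)"
        unfolding filterlim_iff by blast
      then obtain n where "ereal H < f 1 (Z n)"
        by (auto simp: eventually_sequentially)
      then have "H < ?F 1 (Z n)"
        using eff_domain_eq[OF Zdom[of n]] by (metis less_ereal.simps(1))
      moreover have "0 \<le> (real (Suc n) - 1 / 2) * (norm (x - Z n))\<^sup>2"
        by simp
      ultimately show False
        using bound[of n] by linarith
    qed
  qed
qed auto

end
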